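(* Let $n\ge 1$ be an integer. Let $PBT_{n+2}$ be the set of planar binary rooted trees with $n+2$ leaves, let $M(t)\in\mathbb{R}^{n+1}$ be the Tamari point of $t\in PBT_{n+2}$, let $KT^{n}\subset\mathbb{R}^{n+1}$ be the Tamari polytope, i.e. the convex hull of the points $M(t)$ for $t\in PBT_{n+2}$, let $\psi: PBT_{n+2}\to\{\pm\}^{n}$ be the canopy map, and let $\sigma:\{\pm\}^{n}\to PBT_{n+2}$ be its section described in the context. Then $KT^{n}$ is a polytope combinatorially equivalent to the $n$-dimensional hypercube, and its extremal points (vertices) are the points $M(\sigma(\alpha))$ for $\alpha\in\{\pm\}^{n}$. Moreover, for any tree $t\in PBT_{n+2}$, the point $M(t)$ lies on a proper face of this (combinatorial) hypercube $KT^{n}$ that contains the point $M(\sigma(\psi(t)))$.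
   Context: Trees and parenthesizings. A planar binary rooted tree is either the trivial tree $|$ (a single leaf) or a grafting $t=t^{l}\vee t^{r}$ of two planar binary rooted trees (left part $t^{l}$ and right part $t^{r}$ joined at a new vertex above a new root). $PBT_{m}$ is the set of such trees with $m$ leaves (equivalently $m-1$ internal vertices). A tree $t\in PBT_{n+2}$ is identified with a complete parenthesizing of the word $x_{0}x_{1}\cdots x_{n+1}$, the leaves being labelled $x_0,\dots,x_{n+1}$ from left to right and each internal vertex giving one pair of parentheses (the outermost pair, corresponding to the root vertex, is included, so there are $n+1$ pairs). Tamari point. For $t\in PBT_{n+2}$, set $M(t)=(a_{0},\dots,a_{n})\in\mathbb{R}^{n+1}$, where $a_{i}$ is the number of opening parentheses standing immediately in front of $x_{i}$ (that is, between $x_{i-1}$ and $x_i$ if $i\ge1$, and before $x_0$ if $i=0$) in the parenthesizing corresponding to $t$. For example $((x_0x_1)x_2)$ gives $(2,0)$ and $(x_0(x_1x_2))$ gives $(1,1)$. One has $\sum_i a_i=n+1$, so all points $M(t)$ lie in a common hyperplane of $\mathbb{R}^{n+1}$. Tamari polytope. $KT^{n}$ is the convex hull of $\{M(t): t\in PBT_{n+2}\}$. Canopy. The interior leaves of $t\in PBT_{n+2}$ are $x_1,\dots,x_n$ (the two extremal leaves $x_0$ and $x_{n+1}$ are discarded). The canopy $\psi(t)\in\{\pm\}^{n}$ has $i$-th entry $-$ if the leaf $x_i$ points to the left (it is the left child of its parent vertex) and $+$ if $x_i$ points to the right (it is the right child of its parent vertex). The section $\sigma$. For $\alpha\in\{\pm\}^{n}$,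 the tree $\sigma(\alpha)\in PBT_{n+2}$ with canopy $\alpha$ is drawn as follows: first draw the outer part of the tree (the left side ending at leaf $x_0$ and the right side ending at leaf $x_{n+1}$); then, for each $i$ with $\alpha_i=-$, draw from the leaf $x_i$ an edge going down to the right all the way to the right side of the tree; then complete the tree by drawing the right leaves (for each $i$ with $\alpha_i=+$, the edge from $x_i$ goes down to the left until it meets a line already drawn). Equivalently: cut $x_0x_1\cdots x_n$ into consecutive blocks $B_0,\dots,B_k$, a new block starting at $x_0$ and at each $x_i$ with $\alpha_i=-$; parenthesize each block $B_j$ as a left comb $L_j=((\cdot\,\cdot)\cdot)\cdots$ (a single letter if $B_j$ has one letter); then $\sigma(\alpha)=(L_0(L_1(\cdots(L_k\,x_{n+1})\cdots)))$. For example $\sigma(-)=(x_0(x_1x_2))$, $\sigma(-,+)=(x_0((x_1x_2)x_3))$, $\sigma(-,-)=(x_0(x_1(x_2x_3)))$. One has $\psi\circ\sigma=\mathrm{id}$. *)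

theory Defs
  imports "HOL-Analysis.Analysis"
begin

datatype pbt = Leaf | Graft pbt pbt

fun leaves :: "pbt \<Rightarrow> nat" where
  "leaves Leaf = 1"
| "leaves (Graft l r) = leaves l + leaves r"

definition PBT :: "nat \<Rightarrow> pbt set" where
  "PBT m = {t. leaves t = m}"

datatype token = Open | Close | Letter nat

text \<open>The parenthesized word of a tree, its letters being numbered consecutively from k on.\<close>

fun paren_from :: "nat \<Rightarrow> pbt \<Rightarrow> token list" where
  "paren_from k Leaf = [Letter k]"
| "paren_from k (Graft l r) = [Open] @ paren_from k l @ paren_from (k + leaves l) r @ [Close]"

definition parenthesizing :: "pbt \<Rightarrow> token list" where
  "parenthesizing t = paren_from 0 t"

text \<open>Length of the maximal run of opening parentheses that ends right before the letter i.\<close>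

definition opens_before :: "nat \<Rightarrow> token list \<Rightarrow> nat" where
  "opens_before i w =
     length (takeWhile (\<lambda>c. c = Open) (rev (takeWhile (\<lambda>c. c \<noteq> Letter i) w)))"

text \<open>
  The coordinates of a vector in \<open>real ^ 'd\<close> are listed in the order of the index type: the
  index \<open>i\<close> is the one numbered \<open>card {..<i}\<close>, so that the numbers run from \<open>0\<close>
  to \<open>CARD('d) - 1\<close>.
\<close>

definition tamari_point :: "pbt \<Rightarrow> real ^ 'd::{finite,linorder}" where
  "tamari_point t = (\<chi> i. real (opens_before (card {..<i}) (parenthesizing t)))"

text \<open>Meant for \<open>CARD('d) = n + 1\<close>.\<close>

definition tamari_polytope :: "nat \<Rightarrow> (real ^ 'd::{finite,linorder}) set" where
  "tamari_polytope n = convex hull (tamari_point ` PBT (n + 2))"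

text \<open>Sign vectors of length n are lists; the sign of index i (from 1 to n) sits at position i - 1.\<close>

datatype pm_sign = Neg | Pos

text \<open>
  The directions of all leaves from left to right, \<open>Neg\<close> for a left child and \<open>Pos\<close>
  for a right child. The first argument is the direction of the root of the given subtree; it
  affects the result only if that subtree is a single leaf.
\<close>

fun leaf_directions :: "pm_sign \<Rightarrow> pbt \<Rightarrow> pm_sign list" where
  "leaf_directions s Leaf = [s]"
| "leaf_directions s (Graft l r) = leaf_directions Neg l @ leaf_directions Pos r"

definition canopy :: "pbt \<Rightarrow> pm_sign list" where
  "canopy t = butlast (tl (leaf_directions Neg t))"

text \<open>The left comb on m + 1 letters.\<close>

fun left_comb :: "nat \<Rightarrow> pbt" where
  "left_comb 0 = Leaf"
| "left_comb (Suc m) = Graft (left_comb m) Leaf"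

text \<open>
  \<open>block_combs 0 \<alpha>\<close> is the list of the left combs on the blocks into which
  \<open>\<alpha>\<close> cuts the letters of index 0 to n. The first argument is the number of letters
  following the first letter in the current block.
\<close>

fun block_combs :: "nat \<Rightarrow> pm_sign list \<Rightarrow> pbt list" where
  "block_combs m [] = [left_comb m]"
| "block_combs m (Pos # \<alpha>) = block_combs (Suc m) \<alpha>"
| "block_combs m (Neg # \<alpha>) = left_comb m # block_combs 0 \<alpha>"

text \<open>The final \<open>Leaf\<close> is the last letter, of index n + 1.\<close>

definition canopy_section :: "pm_sign list \<Rightarrow> pbt" where
  "canopy_section \<alpha> = foldr Graft (block_combs 0 \<alpha>) Leaf"

text \<open>
  Isomorphism of the face lattices, in which \<open>face_of\<close> admits the empty face and the
  whole polytope.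
\<close>

definition combinatorially_equivalent ::
    "'a::euclidean_space set \<Rightarrow> 'b::euclidean_space set \<Rightarrow> bool" where
  "combinatorially_equivalent P Q \<longleftrightarrow>
     (\<exists>\<phi>. bij_betw \<phi> {F. F face_of P} {G. G face_of Q} \<and>
          (\<forall>F G. F face_of P \<longrightarrow> G face_of P \<longrightarrow> (F \<subseteq> G \<longleftrightarrow> \<phi> F \<subseteq> \<phi> G)))"

definition hypercube :: "(real ^ 'm) set" where
  "hypercube = cbox 0 1"

end

theory Submission
  imports Defs
begin

text \<open>
  Reading the coordinates from the last one backwards, the points \<open>M(t)\<close> satisfy
  \<open>a\<^sub>i \<ge> 0\<close> and \<open>a\<^sub>i + \<dots> + a\<^sub>n \<le> n + 1 - i\<close> for
  \<open>1 \<le> i \<le> n\<close>. These pairs of inequalities cut out a distorted cube: given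
  \<open>a\<^sub>i\<^sub>+\<^sub>1, \<dots>, a\<^sub>n\<close>, the coordinate \<open>a\<^sub>i\<close> ranges over an interval of positive
  length. Rescaling these intervals is a bijection onto the cube that preserves which inequalities
  are tight, and the nonempty faces of a system of inequalities are exactly its tight sets, so the
  bijection carries faces to faces. The vertices make one inequality of each pair tight, and
  \<open>\<sigma>(\<alpha>)\<close> makes the first one tight where \<open>\<alpha>\<^sub>i = +\<close> and the second one where
  \<open>\<alpha>\<^sub>i = -\<close>; by Krein--Milman the \<open>M(\<sigma>(\<alpha>))\<close> then span everything. Finally
  \<open>a\<^sub>n \<in> {0, 1}\<close> for every tree, with the value determined by the canopy, which gives the common facet.
\<close>

subsection \<open>Faces of a system of affine inequalities\<close>

text \<open>The parameter \<open>u\<close> ranges over all reals, so the identity also covers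
  extrapolation beyond the segment, which is used to prolong a line inside the polytope.\<close>

definition affine_functional :: "('a::real_vector \<Rightarrow> real) \<Rightarrow> bool" where
  "affine_functional f \<longleftrightarrow>
     (\<forall>x y u. f ((1 - u) *\<^sub>R x + u *\<^sub>R y) = (1 - u) * f x + u * f y)"

lemma affine_functionalD:
  "affine_functional f \<Longrightarrow> f ((1 - u) *\<^sub>R x + u *\<^sub>R y) = (1 - u) * f x + u * f y"
  unfolding affine_functional_def by (elim allE)

lemma convex_affine_system:
  assumes "affine A" and aff: "\<And>j. j \<in> J \<Longrightarrow> affine_functional (f j)"
  shows "convex {x \<in> A. \<forall>j\<in>J. 0 \<le> f j x}"
  unfolding convex_alt
proof (intro ballI allI impI CollectI conjI)
  fix x y u j assume xy: "x \<in> {x \<in> A. \<forall>j\<in>J. 0 \<le> f j x}" "y \<in> {x \<in> A. \<forall>j\<in>J. 0 \<le> f j x}"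
    and u: "0 \<le> u \<and> u \<le> (1::real)"
  then show "(1 - u) *\<^sub>R x + u *\<^sub>R y \<in> A"
    by (intro mem_affine[OF \<open>affine A\<close>]) auto
  assume j: "j \<in> J"
  show "0 \<le> f j ((1 - u) *\<^sub>R x + u *\<^sub>R y)"
    unfolding affine_functionalD[OF aff[OF j]] using xy u j by simp
qed

text \<open>A convex combination of nonnegative values with positive weights vanishes only if each
  value does, so a tight inequality inside a segment is tight at both ends.\<close>

lemma tight_set_face_of:
  assumes "affine A" and aff: "\<And>j. j \<in> J \<Longrightarrow> affine_functional (f j)" and "T \<subseteq> J"
  defines "P \<equiv> {x \<in> A. \<forall>j\<in>J. 0 \<le> f j x}"
  shows "{x \<in> P. \<forall>j\<in>T. f j x = 0} face_of P"
  unfolding face_of_def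
proof (intro conjI ballI impI)
  \<comment> \<open>Splitting equality into two opposite inequalities reduces convexity to that of
    an affine system.\<close>
  have "{x \<in> P. \<forall>j\<in>T. f j x = 0} = P \<inter> {x \<in> A. \<forall>j\<in>T. 0 \<le> - f j x}"
    using \<open>T \<subseteq> J\<close> by (force simp: P_def)
  moreover have "convex {x \<in> A. \<forall>j\<in>T. 0 \<le> - f j x}"
  proof (rule convex_affine_system[OF \<open>affine A\<close>])
    show "affine_functional (\<lambda>x. - f j x)" if "j \<in> T" for j
    proof -
      have "j \<in> J" using that \<open>T \<subseteq> J\<close> by blast
      then show ?thesis
        unfolding affine_functional_def affine_functionalD[OF aff[OF \<open>j \<in> J\<close>]] by simp
    qed
  qed
  moreover have "convex P"
    unfolding P_def by (rule convex_affine_system[OF \<open>affine A\<close> aff])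
  ultimately show "convex {x \<in> P. \<forall>j\<in>T. f j x = 0}" by (simp add: convex_Int)
next
  fix a b x assume a: "a \<in> P" and b: "b \<in> P" and x: "x \<in> {x \<in> P. \<forall>j\<in>T. f j x = 0}"
    and "x \<in> open_segment a b"
  then obtain u where u: "0 < u" "u < 1" "x = (1 - u) *\<^sub>R a + u *\<^sub>R b"
    by (auto simp: in_segment)
  have "f j a = 0 \<and> f j b = 0" if "j \<in> T" for j
  proof -
    have "j \<in> J" using that \<open>T \<subseteq> J\<close> by auto
    then have "0 \<le> f j a" "0 \<le> f j b" using a b by (auto simp: P_def)
    moreover have "(1 - u) * f j a + u * f j b = 0"
      unfolding affine_functionalD[OF aff[OF \<open>j \<in> J\<close>], symmetric] u(3)[symmetric] using x that by blast
    ultimately have "(1 - u) * f j a = 0" "u * f j b = 0"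
      using u by (simp_all add: add_nonneg_eq_0_iff)
    then show ?thesis using u by simp
  qed
  then show "a \<in> {x \<in> P. \<forall>j\<in>T. f j x = 0}" "b \<in> {x \<in> P. \<forall>j\<in>T. f j x = 0}"
    using a b by auto
qed auto

text \<open>A midpoint makes a nonnegative function vanish only where both ends do. Averaging in a
  point off each hyperplane that does not contain \<open>F\<close> gives a point tight only where
  all of \<open>F\<close> is.\<close>

lemma convex_ex_generic_point:
  assumes "finite J" "convex F" "F \<noteq> {}"
    and aff: "\<And>j. j \<in> J \<Longrightarrow> affine_functional (f j)"
    and nn: "\<And>j x. j \<in> J \<Longrightarrow> x \<in> F \<Longrightarrow> 0 \<le> f j x"
  shows "\<exists>x\<in>F. \<forall>j\<in>J. f j x = 0 \<longrightarrow> (\<forall>y\<in>F. f j y = 0)"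
  using \<open>finite J\<close> aff nn
proof (induction J)
  case empty
  then show ?case using \<open>F \<noteq> {}\<close> by auto
next
  case (insert k J)
  then obtain x where x: "x \<in> F" "\<forall>j\<in>J. f j x = 0 \<longrightarrow> (\<forall>y\<in>F. f j y = 0)"
    using insert.IH[OF insert.prems] by auto
  show ?case
  proof (cases "\<forall>y\<in>F. f k y = 0")
    case True
    then show ?thesis using x by auto
  next
    case False
    then obtain y where y: "y \<in> F" "f k y \<noteq> 0" by auto
    define z where "z = (1 - 1/2) *\<^sub>R x + (1/2::real) *\<^sub>R y"
    have z: "z \<in> F" unfolding z_def by (intro convexD[OF \<open>convex F\<close>]) (use x y in auto)
    have fz: "f j z = f j x / 2 + f j y / 2" if "j \<in> insert k J" for j
      unfolding z_def affine_functionalD[OF insert.prems(1)[OF that]] by simp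
    have "f j z = 0 \<longrightarrow> (\<forall>y\<in>F. f j y = 0)" if "j \<in> insert k J" for j
    proof
      assume "f j z = 0"
      then have "f j x = 0" "f j y = 0"
        using fz[OF that] insert.prems(2)[OF that x(1)] insert.prems(2)[OF that y(1)] by linarith+
      then show "\<forall>y\<in>F. f j y = 0" using x y that by auto
    qed
    then show ?thesis using z by auto
  qed
qed

text \<open>Let \<open>x\<close> be a generic point of a nonempty face \<open>F\<close> and let
  \<open>y\<close> satisfy every equality valid on \<open>F\<close>. The segment from
  \<open>y\<close> to \<open>x\<close> can be prolonged a little beyond \<open>x\<close> inside
  \<open>P\<close>, so \<open>x\<close> is interior to a segment of \<open>P\<close> ending in
  \<open>y\<close>, and the face property puts \<open>y\<close> in \<open>F\<close>.\<close>

lemma face_of_affine_system: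
  assumes "affine A" "finite J" and aff: "\<And>j. j \<in> J \<Longrightarrow> affine_functional (f j)"
  defines "P \<equiv> {x \<in> A. \<forall>j\<in>J. 0 \<le> f j x}"
  shows "F face_of P \<longleftrightarrow> F = {} \<or> (\<exists>T\<subseteq>J. F = {x \<in> P. \<forall>j\<in>T. f j x = 0})"
proof
  assume F: "F face_of P"
  have "\<exists>T\<subseteq>J. F = {x \<in> P. \<forall>j\<in>T. f j x = 0}" if "F \<noteq> {}"
  proof -
    define T where "T = {j \<in> J. \<forall>y\<in>F. f j y = 0}"
    have FP: "F \<subseteq> P" using F by (simp add: face_of_imp_subset)
    obtain x where x: "x \<in> F" "\<And>j. j \<in> J \<Longrightarrow> f j x = 0 \<Longrightarrow> j \<in> T"
    proof -
      have "0 \<le> f j x" if "j \<in> J" "x \<in> F" for j x using that FP by (auto simp: P_def)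
      then have "\<exists>x\<in>F. \<forall>j\<in>J. f j x = 0 \<longrightarrow> (\<forall>y\<in>F. f j y = 0)"
        using face_of_imp_convex[OF F] by (intro convex_ex_generic_point assms \<open>F \<noteq> {}\<close>)
      then show ?thesis using that by (auto simp: T_def)
    qed
    have "y \<in> F" if y: "y \<in> P" "\<forall>j\<in>T. f j y = 0" for y
    proof (cases "y = x")
      case False
      \<comment> \<open>The expression is the value of \<open>f j\<close> at
        \<open>x + e (x - y)\<close>. It is 0 for \<open>j\<close> in \<open>T\<close>; otherwise
        \<open>f j x\<close> is positive and a small \<open>e\<close> keeps it so.\<close>
      have "\<forall>\<^sub>F e in at_right 0. 0 \<le> (1 + e) * f j x - e * f j y" if "j \<in> J" for j
      proof (cases "j \<in> T")
        case True
        then show ?thesis using y x by (auto simp: T_def)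
      next
        case False
        then have "0 < f j x" using x that FP by (force simp: P_def)
        then have "\<forall>\<^sub>F e in at_right (0::real). 0 < (1 + e) * f j x - e * f j y"
          by (intro order_tendstoD(1)[where y = "(1 + 0) * f j x - 0 * f j y"] tendsto_intros) auto
        then show ?thesis by (rule eventually_mono) simp
      qed
      then have "\<forall>\<^sub>F e in at_right (0::real). \<forall>j\<in>J. 0 \<le> (1 + e) * f j x - e * f j y"
        using \<open>finite J\<close> by (intro eventually_ball_finite) auto
      then have "\<forall>\<^sub>F e in at_right (0::real). 0 < e \<and> (\<forall>j\<in>J. 0 \<le> (1 + e) * f j x - e * f j y)"
        by (intro eventually_conj eventually_at_right_less)
      then obtain e :: real where e: "0 < e" "\<And>j. j \<in> J \<Longrightarrow> 0 \<le> (1 + e) * f j x - e * f j y"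
        using eventually_happens'[OF trivial_limit_at_right_real[of 0]] by blast
      define z where "z = (1 - (- e)) *\<^sub>R x + (- e) *\<^sub>R y"
      have "x \<in> A" "y \<in> A" using x y FP by (auto simp: P_def)
      then have "z \<in> A" using \<open>affine A\<close> unfolding z_def affine_alt by blast
      moreover have "f j z = (1 + e) * f j x - e * f j y" if "j \<in> J" for j
        unfolding z_def affine_functionalD[OF aff[OF that]] by simp
      ultimately have "z \<in> P" using e by (simp add: P_def)
      moreover have "x \<in> open_segment z y"
      proof -
        \<comment> \<open>Solving \<open>z = (1 + e) x - e y\<close> for \<open>x\<close> gives the
          weights \<open>1 / (1 + e)\<close> and \<open>e / (1 + e)\<close>.\<close>
        have "1 - e / (1 + e) = 1 / (1 + e)" using e by (simp add: field_simps)
        then have "(1 - e / (1 + e)) *\<^sub>R z = x - (e / (1 + e)) *\<^sub>R y"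
          using e by (simp add: z_def scaleR_diff_right)
        then have "x = (1 - e / (1 + e)) *\<^sub>R z + (e / (1 + e)) *\<^sub>R y" by simp
        moreover have "z \<noteq> y"
        proof
          assume "z = y"
          then have "(1 + e) *\<^sub>R (x - y) = 0" by (simp add: z_def algebra_simps)
          then show False using False e by simp
        qed
        ultimately show ?thesis
          using e unfolding in_segment by (intro conjI exI[of _ "e / (1 + e)"]) simp_all
      qed
      ultimately show ?thesis using face_ofD[OF F] x(1) y(1) by blast
    qed (use x in simp)
    then have "{x \<in> P. \<forall>j\<in>T. f j x = 0} \<subseteq> F" by blast
    moreover have "F \<subseteq> {x \<in> P. \<forall>j\<in>T. f j x = 0}" using FP unfolding T_def by blast
    moreover have "T \<subseteq> J" unfolding T_def by blast
    ultimately show "\<exists>T\<subseteq>J. F = {x \<in> P. \<forall>j\<in>T. f j x = 0}"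
      by (intro exI[of _ T] conjI equalityI)
  qed
  then show "F = {} \<or> (\<exists>T\<subseteq>J. F = {x \<in> P. \<forall>j\<in>T. f j x = 0})" by blast
next
  assume "F = {} \<or> (\<exists>T\<subseteq>J. F = {x \<in> P. \<forall>j\<in>T. f j x = 0})"
  then show "F face_of P"
  proof (elim disjE exE conjE)
    fix T assume T: "T \<subseteq> J" and F: "F = {x \<in> P. \<forall>j\<in>T. f j x = 0}"
    show ?thesis
      unfolding F P_def by (rule tight_set_face_of[OF assms(1) aff T])
  qed simp
qed

text \<open>Two systems over the same index set, linked by a bijection that respects tightness.
  Affinity of \<open>h\<close> is not demanded, because the rescaling map to the cube is only
  rational.\<close>

locale tightness_bijection =
  fixes A :: "'a::euclidean_space set" and B :: "'b::euclidean_space set" and J :: "'j set"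
    and f :: "'j \<Rightarrow> 'a \<Rightarrow> real" and g :: "'j \<Rightarrow> 'b \<Rightarrow> real" and h :: "'a \<Rightarrow> 'b" and P Q
  assumes aff: "affine A" "affine B" "finite J"
      "\<And>j. j \<in> J \<Longrightarrow> affine_functional (f j)" "\<And>j. j \<in> J \<Longrightarrow> affine_functional (g j)"
    and P: "P = {x \<in> A. \<forall>j\<in>J. 0 \<le> f j x}"
    and Q: "Q = {y \<in> B. \<forall>j\<in>J. 0 \<le> g j y}"
    and bij: "bij_betw h P Q"
    and tight: "\<And>x j. x \<in> P \<Longrightarrow> j \<in> J \<Longrightarrow> f j x = 0 \<longleftrightarrow> g j (h x) = 0"
begin

text \<open>Nonempty faces on either side are the tight sets of subsets \<open>T\<close> of
  \<open>J\<close>, and \<open>h\<close> carries the tight set of \<open>T\<close> to the tight set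
  of the same \<open>T\<close>.\<close>

lemma face_image_iff:
  assumes "F \<subseteq> P"
  shows "h ` F face_of Q \<longleftrightarrow> F face_of P"
proof -
  have inj: "inj_on h P" and img: "h ` P = Q" using bij by (auto simp: bij_betw_def)
  have "h ` F = {y \<in> Q. \<forall>j\<in>T. g j y = 0} \<longleftrightarrow> F = {x \<in> P. \<forall>j\<in>T. f j x = 0}"
    if "T \<subseteq> J" for T
  proof -
    have "f j x = 0 \<longleftrightarrow> g j (h x) = 0" if "x \<in> P" "j \<in> T" for x j
      using tight that \<open>T \<subseteq> J\<close> by blast
    then have "{y \<in> Q. \<forall>j\<in>T. g j y = 0} = h ` {x \<in> P. \<forall>j\<in>T. f j x = 0}"
      unfolding img[symmetric] by auto
    then show ?thesis
      using inj_on_image_eq_iff[OF inj assms, of "{x \<in> P. \<forall>j\<in>T. f j x = 0}"] by auto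
  qed
  then have "(\<exists>T\<subseteq>J. h ` F = {y \<in> Q. \<forall>j\<in>T. g j y = 0})
      \<longleftrightarrow> (\<exists>T\<subseteq>J. F = {x \<in> P. \<forall>j\<in>T. f j x = 0})"
    by (intro ex_cong1 conj_cong refl)
  moreover have "F face_of P \<longleftrightarrow> F = {} \<or> (\<exists>T\<subseteq>J. F = {x \<in> P. \<forall>j\<in>T. f j x = 0})"
    unfolding P by (rule face_of_affine_system[OF aff(1,3,4)])
  moreover have "h ` F face_of Q \<longleftrightarrow> h ` F = {} \<or> (\<exists>T\<subseteq>J. h ` F = {y \<in> Q. \<forall>j\<in>T. g j y = 0})"
    unfolding Q by (rule face_of_affine_system[OF aff(2,3,5)])
  ultimately show ?thesis by (simp only: image_is_empty)
qed

lemma combinatorially_equivalent: "combinatorially_equivalent P Q"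
  unfolding combinatorially_equivalent_def
proof (intro exI[of _ "image h"] conjI allI impI)
  have inj: "inj_on (image h) (Pow P)"
    using bij by (simp add: bij_betw_def inj_on_image_Pow)
  have "image h ` {F. F face_of P} = {G. G face_of Q}"
  proof (intro equalityI subsetI)
    fix G assume "G \<in> {G. G face_of Q}"
    then have G: "G face_of Q" by simp
    then have "G \<subseteq> h ` P" using bij by (simp add: bij_betw_def face_of_imp_subset)
    then obtain F where "F \<subseteq> P" "G = h ` F" by (meson subset_imageE)
    then show "G \<in> image h ` {F. F face_of P}" using G face_image_iff by auto
  qed (use face_image_iff face_of_imp_subset in auto)
  moreover have "inj_on (image h) {F. F face_of P}"
    by (rule inj_on_subset[OF inj]) (use face_of_imp_subset in blast)
  ultimately show "bij_betw (image h) {F. F face_of P} {G. G face_of Q}"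
    by (simp only: bij_betw_def)
next
  fix F G assume "F face_of P" "G face_of P"
  then show "F \<subseteq> G \<longleftrightarrow> h ` F \<subseteq> h ` G"
    using bij_betw_imp_inj_on[OF bij] by (simp add: face_of_imp_subset inj_on_image_subset_iff)
qed

lemma extreme_point_image_iff:
  assumes "x \<in> P"
  shows "h x extreme_point_of Q \<longleftrightarrow> x extreme_point_of P"
  using face_image_iff[of "{x}"] assms by (simp add: face_of_singleton)

end

subsection \<open>Opening parentheses of a tree\<close>

text \<open>The Tamari coordinates computed along the tree: grafting puts one new parenthesis in
  front of the first letter. The list also has an entry for the last letter, which a Tamari point
  omits.\<close>

fun opens :: "pbt \<Rightarrow> nat list" where
  "opens Leaf = [0]"
| "opens (Graft l r) = Suc (hd (opens l)) # tl (opens l) @ opens r"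

lemma length_opens [simp]: "length (opens t) = leaves t"
proof (induction t)
  case (Graft l r)
  moreover have "opens l \<noteq> []" by (cases l) auto
  ultimately show ?case by (cases "opens l") auto
qed simp

lemma leaves_pos [simp]: "0 < leaves t"
  by (induction t) auto

lemma opens_nonempty [simp]: "opens t \<noteq> []"
  by (cases t) auto

lemma last_opens: "last (opens t) = 0"
  by (induction t) auto

section \<open>Counting opening parentheses in the word of a tree\<close>

lemma set_paren_from: "Letter i \<in> set (paren_from k t) \<longleftrightarrow> k \<le> i \<and> i < k + leaves t"
  by (induction k t rule: paren_from.induct) auto

lemma paren_from_nonempty [simp]: "paren_from k t \<noteq> []"
  by (cases t) auto

lemma last_paren_from: "last (paren_from k t) \<noteq> Open"
  by (cases t) auto

lemma takeWhile_paren_from_first: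
  "takeWhile (\<lambda>c. c \<noteq> Letter k) (paren_from k t) = replicate (hd (opens t)) Open"
proof (induction t arbitrary: k)
  case (Graft l r)
  have "Letter k \<in> set (paren_from k l)" by (simp add: set_paren_from)
  then show ?case using Graft.IH(1)[of k] by (simp add: takeWhile_append1)
qed simp

lemma opens_before_append1:
  "Letter i \<in> set v \<Longrightarrow> opens_before i (v @ w) = opens_before i v"
  by (simp add: opens_before_def takeWhile_append1)

text \<open>The last token of \<open>v\<close> stops the run of opening parentheses, so the run
  cannot reach back into \<open>v\<close>.\<close>

lemma opens_before_append2:
  assumes "Letter i \<notin> set v" "v \<noteq> []" "last v \<noteq> Open"
  shows "opens_before i (v @ w) = opens_before i w"
proof -
  let ?w = "rev (takeWhile (\<lambda>c. c \<noteq> Letter i) w)"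
  have "takeWhile (\<lambda>c. c \<noteq> Letter i) (v @ w) = v @ takeWhile (\<lambda>c. c \<noteq> Letter i) w"
    using assms by (subst takeWhile_append2) auto
  moreover have "takeWhile (\<lambda>c. c = Open) (rev v) = []"
    using assms by (cases v rule: rev_cases) auto
  ultimately show ?thesis
    by (cases "\<forall>c\<in>set ?w. c = Open")
      (simp_all add: opens_before_def takeWhile_append takeWhile_eq_all_conv[THEN iffD2])
qed

lemma opens_before_Open:
  assumes "c \<in> set (takeWhile (\<lambda>c. c \<noteq> Letter i) w)" "c \<noteq> Open"
  shows "opens_before i (Open # w) = opens_before i w"
  using assms by (simp add: opens_before_def takeWhile_append1)

lemma opens_before_paren_from:
  "i < leaves t \<Longrightarrow> opens_before (k + i) (paren_from k t) = opens t ! i"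
proof (induction t arbitrary: k i)
  case (Graft l r)
  let ?w = "paren_from k l @ paren_from (k + leaves l) r @ [Close]"
  show ?case
  proof (cases "i = 0")
    case True
    have "opens_before k (paren_from k (Graft l r)) = hd (opens (Graft l r))"
      unfolding opens_before_def takeWhile_paren_from_first
      by (simp add: takeWhile_eq_all_conv[THEN iffD2])
    then show ?thesis using True by simp
  next
    case False
    have k: "Letter k \<in> set (paren_from k l)" by (simp add: set_paren_from)
    \<comment> \<open>The first letter separates the outermost parenthesis from every later letter,
      so that parenthesis counts only for \<open>i = 0\<close>.\<close>
    have "Letter k \<in> set (takeWhile (\<lambda>c. c \<noteq> Letter (k + i)) ?w)"
    proof (cases "Letter (k + i) \<in> set (paren_from k l)")
      case True
      then obtain u v where uv: "paren_from k l = u @ Letter (k + i) # v" "Letter (k + i) \<notin> set u"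
        by (meson split_list_first)
      have tw: "takeWhile (\<lambda>c. c \<noteq> Letter (k + i)) ?w = u"
        unfolding uv using uv(2) by (auto simp: takeWhile_append2 takeWhile_tail)
      have "Letter k \<in> set u"
      proof (rule ccontr)
        \<comment> \<open>Otherwise \<open>Letter (k + i)\<close> would precede
          \<open>Letter k\<close>, but only opening parentheses do.\<close>
        assume "Letter k \<notin> set u"
        then have "takeWhile (\<lambda>c. c \<noteq> Letter k) (paren_from k l)
          = u @ takeWhile (\<lambda>c. c \<noteq> Letter k) (Letter (k + i) # v)"
          unfolding uv by (subst takeWhile_append2) auto
        then have "Letter (k + i) \<in> set (takeWhile (\<lambda>c. c \<noteq> Letter k) (paren_from k l))"
          using False by simp
        then show False by (simp add: takeWhile_paren_from_first)
      qed
      then show ?thesis by (simp only: tw)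
    next
      case False
      then have "set (paren_from k l) \<subseteq> set (takeWhile (\<lambda>c. c \<noteq> Letter (k + i)) ?w)"
        by (subst takeWhile_append2) auto
      then show ?thesis using k by auto
    qed
    then have *: "opens_before (k + i) (paren_from k (Graft l r)) = opens_before (k + i) ?w"
      by (simp add: opens_before_Open)
    show ?thesis
    proof (cases "i < leaves l")
      case True
      then have "opens_before (k + i) ?w = opens l ! i"
        using Graft.IH(1) by (simp add: opens_before_append1 set_paren_from)
      then show ?thesis
        using * True False by (auto simp: nth_append nth_tl nth_Cons split: nat.split)
    next
      case ge: False
      define i' where "i' = i - leaves l"
      have i: "i = leaves l + i'" "i' < leaves r" using ge Graft.prems by (auto simp: i'_def)
      have "opens_before (k + i) ?w = opens_before ((k + leaves l) + i') (paren_from (k + leaves l) r)"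
        using i by (simp add: opens_before_append1 opens_before_append2 set_paren_from last_paren_from add.assoc)
      also have "\<dots> = opens r ! i'" using Graft.IH(2) i by simp
      finally show ?thesis
        using * i by (cases "opens l") (auto simp: nth_append nth_Cons' dest: arg_cong[of _ _ length])
    qed
  qed
qed (simp add: opens_before_def)

text \<open>There is one pair of parentheses per internal vertex, and a binary tree has one vertex
  fewer than leaves.\<close>

lemma sum_list_opens: "Suc (sum_list (opens t)) = leaves t"
proof (induction t)
  case (Graft l r)
  then show ?case by (cases "opens l") (use opens_nonempty[of l] in auto)
qed simp

text \<open>Parentheses opening at letter \<open>i\<close> or later belong to vertices all of whose
  leaves have index at least \<open>i\<close>. These vertices form a binary forest on the last
  \<open>leaves t - i\<close> leaves, hence are fewer than those leaves.\<close>

lemma sum_list_drop_opens: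
  "i < leaves t \<Longrightarrow> sum_list (drop i (opens t)) + Suc i \<le> leaves t"
proof (induction t arbitrary: i)
  case (Graft l r)
  obtain a as where l: "opens l = a # as" using opens_nonempty[of l] by (cases "opens l") auto
  then have len: "leaves l = Suc (length as)" using length_opens[of l] by simp
  show ?case
  proof (cases i)
    case 0
    then show ?thesis using sum_list_opens[of "Graft l r"] by simp
  next
    case (Suc j)
    show ?thesis
    proof (cases "i < leaves l")
      case True
      then show ?thesis
        using Graft.IH(1)[of i] sum_list_opens[of r] l len Suc by simp
    next
      case False
      then show ?thesis
        using Graft.IH(2)[of "i - leaves l"] Graft.prems l len Suc by (simp add: not_less) linarith
    qed
  qed
qed simp

section \<open>The canopy in terms of opening parentheses\<close>

abbreviation direction :: "nat \<Rightarrow> pm_sign" where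
  "direction a \<equiv> if a = 0 then Pos else Neg"

text \<open>A leaf is a left child exactly when its parent's parenthesis opens directly in front of
  it. Only the first leaf can depend on the direction of the root: with \<open>Neg\<close> it always
  points left.\<close>

lemma leaf_directions_opens:
  "leaf_directions Pos t = map direction (opens t)"
  "leaf_directions Neg t = Neg # map direction (tl (opens t))"
  by (induction t) (auto simp: map_tl)

lemma length_canopy: "length (canopy t) = leaves t - 2"
  by (simp add: canopy_def leaf_directions_opens)

lemma canopy_nth:
  "k < leaves t - 2 \<Longrightarrow> canopy t ! k = direction (opens t ! Suc k)"
  by (simp add: canopy_def leaf_directions_opens nth_butlast nth_tl)

subsection \<open>The section of the canopy map\<close>

text \<open>\<open>canopy_section\<close> with a first block that already holds \<open>m\<close>
  further letters, the generality needed for induction along \<open>block_combs\<close>.\<close>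

abbreviation comb_tree :: "nat \<Rightarrow> pm_sign list \<Rightarrow> pbt" where
  "comb_tree m \<alpha> \<equiv> foldr Graft (block_combs m \<alpha>) Leaf"

lemma opens_left_comb: "opens (left_comb m) = m # replicate m 0"
  by (induction m) (auto simp: replicate_append_same)

lemma leaves_left_comb [simp]: "leaves (left_comb m) = Suc m"
  by (induction m) auto

lemma leaves_comb_tree: "leaves (comb_tree m \<alpha>) = m + length \<alpha> + 2"
  by (induction m \<alpha> rule: block_combs.induct) auto

lemma leaves_canopy_section: "leaves (canopy_section \<alpha>) = length \<alpha> + 2"
  by (simp add: canopy_section_def leaves_comb_tree)

lemma opens_comb_tree_first_block:
  "0 < i \<Longrightarrow> i \<le> m \<Longrightarrow> opens (comb_tree m \<alpha>) ! i = 0"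
  by (induction m \<alpha> rule: block_combs.induct) (auto simp: opens_left_comb nth_append nth_Cons')

text \<open>The sign at position \<open>k\<close> belongs to letter \<open>Suc m + k\<close>. With
  \<open>Pos\<close> the letter continues a left comb and nothing opens before it. With
  \<open>Neg\<close> it starts a block, and the letters from there on form a full subtree with
  \<open>length \<alpha> - k + 1\<close> leaves.\<close>

lemma opens_comb_tree:
  assumes "k < length \<alpha>"
  shows "\<alpha> ! k = Pos \<Longrightarrow> opens (comb_tree m \<alpha>) ! (Suc m + k) = 0"
    and "\<alpha> ! k = Neg \<Longrightarrow> sum_list (drop (Suc m + k) (opens (comb_tree m \<alpha>))) = length \<alpha> - k"
  using assms
proof (induction m \<alpha> arbitrary: k rule: block_combs.induct)
  case (2 m \<alpha>)
  {
    case 1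
    then show ?case
      using 2(1)[of "k - 1"] opens_comb_tree_first_block[of "Suc m" "Suc m" \<alpha>]
      by (cases k) auto
  next
    case 2
    then show ?case using "2.IH"(2)[of "k - 1"] by (cases k) auto
  }
next
  case (3 m \<alpha>)
  have o: "opens (comb_tree m (Neg # \<alpha>)) = (Suc m # replicate m 0) @ opens (comb_tree 0 \<alpha>)"
    by (simp add: opens_left_comb)
  {
    case 1
    then show ?case
      using "3.IH"(1)[of "k - 1"] unfolding o by (cases k) (auto simp: nth_append)
  next
    case 2
    then show ?case
      using "3.IH"(2)[of "k - 1"] sum_list_opens[of "comb_tree 0 \<alpha>"] unfolding o
      by (cases k) (auto simp: leaves_comb_tree)
  }
qed auto

lemma opens_canopy_section:
  assumes "k < length \<alpha>"
  shows "\<alpha> ! k = Pos \<Longrightarrow> opens (canopy_section \<alpha>) ! Suc k = 0"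
    and "\<alpha> ! k = Neg \<Longrightarrow> sum_list (drop (Suc k) (opens (canopy_section \<alpha>))) = length \<alpha> - k"
  using opens_comb_tree[OF assms, of 0] by (simp_all add: canopy_section_def)

subsection \<open>Inequalities for the Tamari polytope\<close>

lemma card_below_above:
  fixes i :: "'d::{finite,linorder}"
  shows "Suc (card {..<i} + card {i<..}) = CARD('d::{finite,linorder})"
proof -
  have "insert i ({..<i} \<union> {i<..}) = UNIV" by auto
  moreover have "card (insert i ({..<i} \<union> {i<..})) = Suc (card ({..<i} \<union> {i<..}))"
    by (rule card_insert_disjoint) auto
  moreover have "card ({..<i} \<union> {i<..}) = card {..<i} + card {i<..}"
    by (rule card_Un_disjoint) auto
  ultimately show ?thesis by (simp only:)
qed

lemma bij_betw_card_above:
  "bij_betw (\<lambda>i::'d::{finite,linorder}. card {i<..}) UNIV {..<CARD('d::{finite,linorder})}"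
proof -
  have "card {j<..} < card {i<..}" if "i < j" for i j :: 'd
    using that by (intro psubset_card_mono) auto
  then have inj: "inj (\<lambda>i::'d. card {i<..})"
    by (intro linorder_injI) (metis less_irrefl)
  moreover have "range (\<lambda>i::'d. card {i<..}) \<subseteq> {..<CARD('d)}"
  proof clarify
    fix i :: 'd
    show "card {i<..} < CARD('d)" using card_below_above[of i] by linarith
  qed
  ultimately show ?thesis
    by (simp add: bij_betw_def card_image card_subset_eq)
qed

text \<open>The index with exactly \<open>j\<close> indices above it. For \<open>n + 1\<close>
  coordinates it is the index of \<open>a\<^sub>i\<close> with \<open>i = n - j\<close>.\<close>

definition from_last :: "nat \<Rightarrow> 'd::{finite,linorder}" where
  "from_last = inv_into UNIV (\<lambda>i. card {i<..})"

lemma from_last_card_above [simp]: "from_last (card {i<..}) = i"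
  unfolding from_last_def using bij_betw_card_above by (intro inv_into_f_f) (auto simp: bij_betw_def)

lemma card_above_from_last [simp]:
  "j < CARD('d::{finite,linorder}) \<Longrightarrow> card {from_last j :: 'd::{finite,linorder}<..} = j"
  unfolding from_last_def using bij_betw_card_above[where ?'d = 'd]
  by (intro f_inv_into_f[where f = "\<lambda>i::'d. card {i<..}"]) (auto simp: bij_betw_def)

lemma card_below_from_last:
  "j < CARD('d::{finite,linorder}) \<Longrightarrow> card {..<from_last j :: 'd::{finite,linorder}} = CARD('d::{finite,linorder}) - Suc j"
  using card_below_above[of "from_last j :: 'd"] by simp

lemma vec_eq_from_last:
  fixes x y :: "'a ^ 'd::{finite,linorder}"
  assumes "\<And>j. j < CARD('d::{finite,linorder}) \<Longrightarrow> x $ from_last j = y $ from_last j"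
  shows "x = y"
proof (subst vec_eq_iff, rule allI)
  fix i :: 'd
  show "x $ i = y $ i"
    using assms[of "card {i<..}"] card_below_above[of i] by simp
qed

definition tail_sum :: "(real, 'd::{finite,linorder}) vec \<Rightarrow> nat \<Rightarrow> real" where
  "tail_sum x j = (\<Sum>k<j. x $ from_last k)"

lemma tail_sum_0 [simp]: "tail_sum x 0 = 0"
  and tail_sum_Suc [simp]: "tail_sum x (Suc j) = tail_sum x j + x $ from_last j"
  by (simp_all add: tail_sum_def)

lemma tail_sum_affine:
  "tail_sum (u *\<^sub>R x + v *\<^sub>R y) j = u * tail_sum x j + v * tail_sum y j"
  by (simp add: tail_sum_def sum.distrib sum_distrib_left)

text \<open>With \<open>i = n - j\<close>, \<open>False\<close> encodes
  \<open>a\<^sub>i \<ge> 0\<close> and \<open>True\<close> encodes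
  \<open>a\<^sub>i + \<dots> + a\<^sub>n \<le> n + 1 - i\<close>. The boolean chooses between two
  opposite facets.\<close>

definition slack :: "bool \<Rightarrow> nat \<Rightarrow> (real, 'd::{finite,linorder}) vec \<Rightarrow> real" where
  "slack b j x = (if b then real (Suc j) - tail_sum x (Suc j) else x $ from_last j)"

lemma affine_functional_slack: "affine_functional (slack b j)"
  unfolding affine_functional_def slack_def tail_sum_affine by (simp add: algebra_simps)

definition slack_polytope :: "nat \<Rightarrow> (real, 'd::{finite,linorder}) vec set" where
  "slack_polytope n = {x. tail_sum x (Suc n) = real (Suc n) \<and> (\<forall>j<n. \<forall>b. 0 \<le> slack b j x)}"

lemma slack_polytope_tail_sum:
  assumes "x \<in> slack_polytope n" "j \<le> n"
  shows "0 \<le> tail_sum x j" "tail_sum x j \<le> j"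
proof -
  have "0 \<le> slack False i x" if "i < n" for i
    using that assms(1) by (simp add: slack_polytope_def)
  then show "0 \<le> tail_sum x j"
    unfolding tail_sum_def using assms(2) by (intro sum_nonneg) (simp add: slack_def)
  show "tail_sum x j \<le> j"
  proof (cases j)
    case (Suc i)
    then have "0 \<le> slack True i x"
      using assms by (simp add: slack_polytope_def)
    then show ?thesis by (simp add: slack_def Suc)
  qed simp
qed

lemma slack_polytope_nonneg:
  "x \<in> slack_polytope n \<Longrightarrow> j < n \<Longrightarrow> 0 \<le> x $ from_last j"
  by (simp add: slack_polytope_def slack_def all_bool_eq)

lemma affine_tail_sum_level: "affine {x. tail_sum x j = c}"
proof -
  have "u * c + v * c = c" if "u + v = 1" for u v :: real
    using that by (simp flip: distrib_right)
  then show ?thesis by (simp add: affine_def tail_sum_affine)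
qed

lemma convex_slack_polytope: "convex (slack_polytope n)"
proof -
  have "slack_polytope n = {x \<in> {x. tail_sum x (Suc n) = real (Suc n)}.
      \<forall>c\<in>{..<n} \<times> UNIV. 0 \<le> slack (snd c) (fst c) x}"
    by (auto simp: slack_polytope_def)
  also have "convex \<dots>"
    by (intro convex_affine_system affine_tail_sum_level affine_functional_slack)
  finally show ?thesis .
qed

lemma compact_slack_polytope:
  assumes "CARD('d::{finite,linorder}) = Suc n"
  shows "compact (slack_polytope n :: (real, 'd::{finite,linorder}) vec set)"
proof -
  have cont: "continuous_on UNIV (\<lambda>x. tail_sum x j)" "continuous_on UNIV (slack b j)" for b j
    unfolding slack_def tail_sum_def by (cases b; auto intro!: continuous_intros)+
  have "slack_polytope n = {x :: (real, 'd) vec. tail_sum x (Suc n) = real (Suc n)}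
      \<inter> (\<Inter>j\<in>{..<n}. \<Inter>b. {x. 0 \<le> slack b j x})"
    unfolding slack_polytope_def by blast
  moreover have "closed {x :: (real, 'd) vec. tail_sum x (Suc n) = real (Suc n)}"
    by (rule closed_Collect_eq[OF cont(1) continuous_on_const])
  moreover have "closed {x :: (real, 'd) vec. 0 \<le> slack b j x}" for b j
    by (rule closed_Collect_le[OF continuous_on_const cont(2)])
  ultimately have "closed (slack_polytope n :: (real, 'd) vec set)"
    by (auto intro!: closed_Int closed_INT)
  moreover have "bounded (slack_polytope n :: (real, 'd) vec set)"
  proof (rule bounded_subset)
    show "bounded (cbox 0 (\<chi> i. real (Suc n)) :: (real, 'd) vec set)" by simp
    show "slack_polytope n \<subseteq> (cbox 0 (\<chi> i. real (Suc n)) :: (real, 'd) vec set)"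
    proof
      fix x :: "(real, 'd) vec" assume x: "x \<in> slack_polytope n"
      have "0 \<le> x $ i \<and> x $ i \<le> real (Suc n)" for i
      proof -
        define j where "j = card {i<..}"
        have i: "i = from_last j" and "j \<le> n"
          using card_below_above[of i] assms by (auto simp: j_def)
        show ?thesis
        \<comment> \<open>The first coordinate has no pair of inequalities; the hyperplane equation
          bounds it.\<close>
        proof (cases "j = n")
          case True
          then have "x $ i = real (Suc n) - tail_sum x n"
            using x by (simp add: slack_polytope_def i)
          then show ?thesis using slack_polytope_tail_sum[OF x, of n] by simp
        next
          case False
          then have "j < n" using \<open>j \<le> n\<close> by simp
          then show ?thesis
            using slack_polytope_tail_sum[OF x, of j] slack_polytope_tail_sum[OF x, of "Suc j"]
              slack_polytope_nonneg[OF x] by (simp add: i)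
        qed
      qed
      then show "x \<in> cbox 0 (\<chi> i. real (Suc n))" by (simp add: mem_box_cart)
    qed
  qed
  ultimately show ?thesis by (simp add: compact_eq_bounded_closed)
qed

section \<open>Tamari points satisfy the inequalities\<close>

lemma tamari_point_from_last:
  assumes "CARD('d::{finite,linorder}) = Suc n" "leaves t = n + 2" "j \<le> n"
  shows "(tamari_point t :: (real, 'd::{finite,linorder}) vec) $ from_last j = opens t ! (n - j)"
  using assms opens_before_paren_from[of "n - j" t 0]
  by (simp add: tamari_point_def parenthesizing_def card_below_from_last)

text \<open>The suffix of \<open>opens t\<close> has one entry more than the tail of the point, that
  of the last letter, and this entry is 0.\<close>

lemma tail_sum_tamari_point:
  assumes "CARD('d::{finite,linorder}) = Suc n" "leaves t = n + 2" "j \<le> Suc n"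
  shows "tail_sum (tamari_point t :: (real, 'd::{finite,linorder}) vec) j = sum_list (drop (Suc n - j) (opens t))"
  using assms(3)
proof (induction j)
  case 0
  have "drop (Suc n) (opens t) = [last (opens t)]"
    using assms(2) Cons_nth_drop_Suc[of "Suc n" "opens t"] by (simp add: last_conv_nth)
  then show ?case by (simp add: last_opens)
next
  case (Suc j)
  have "drop (n - j) (opens t) = opens t ! (n - j) # drop (Suc n - j) (opens t)"
    using Suc.prems assms(2) Cons_nth_drop_Suc[of "n - j" "opens t"] by (simp add: Suc_diff_le)
  then show ?case
    using Suc assms by (simp add: tamari_point_from_last)
qed

lemma tamari_point_in_slack_polytope:
  assumes "CARD('d::{finite,linorder}) = Suc n" "leaves t = n + 2"
  shows "(tamari_point t :: (real, 'd::{finite,linorder}) vec) \<in> slack_polytope n"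
proof -
  have "0 \<le> slack b j (tamari_point t :: (real, 'd) vec)" if "j < n" for b j
  proof (cases b)
    case True
    have "sum_list (drop (n - j) (opens t)) \<le> Suc j"
      using sum_list_drop_opens[of "n - j" t] assms that by linarith
    then have "tail_sum (tamari_point t :: (real, 'd) vec) (Suc j) \<le> real (Suc j)"
      unfolding tail_sum_tamari_point[OF assms Suc_leI[OF less_SucI[OF that]]]
      by (simp del: of_nat_Suc)
    then show ?thesis using True by (simp add: slack_def)
  qed (simp add: slack_def tamari_point_def)
  moreover have "sum_list (opens t) = Suc n" using sum_list_opens[of t] assms by simp
  then have "tail_sum (tamari_point t :: (real, 'd) vec) (Suc n) = real (Suc n)"
    unfolding tail_sum_tamari_point[OF assms order_refl] by simp
  ultimately show ?thesis by (simp add: slack_polytope_def del: tail_sum_Suc)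
qed

text \<open>Coordinate \<open>j\<close> from the end belongs to leaf \<open>n - j\<close>, whose
  sign sits at list position \<open>n - Suc j\<close>. A \<open>Neg\<close> leaf starts a block,
  which makes the upper bound tight; a \<open>Pos\<close> leaf has no parenthesis in front, which
  makes the lower bound tight.\<close>

lemma slack_canopy_section:
  assumes "CARD('d::{finite,linorder}) = Suc n" "length \<alpha> = n" "j < n"
  shows "slack (\<alpha> ! (n - Suc j) = Neg) j (tamari_point (canopy_section \<alpha>) :: (real, 'd::{finite,linorder}) vec) = 0"
proof -
  have l: "leaves (canopy_section \<alpha>) = n + 2" using assms by (simp add: leaves_canopy_section)
  have k: "n - Suc j < length \<alpha>" and Suc: "Suc (n - Suc j) = n - j" using assms by auto
  show ?thesis
  proof (cases "\<alpha> ! (n - Suc j)")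
    case Neg
    then have "sum_list (drop (n - j) (opens (canopy_section \<alpha>))) = Suc j"
      using opens_canopy_section(2)[OF k] Suc assms by simp
    then have "tail_sum (tamari_point (canopy_section \<alpha>) :: (real, 'd) vec) (Suc j) = real (Suc j)"
      using tail_sum_tamari_point[OF assms(1) l, of "Suc j"] assms by (simp del: tail_sum_Suc)
    then show ?thesis using Neg by (simp add: slack_def)
  next
    case Pos
    then show ?thesis
      using opens_canopy_section(1)[OF k] Suc tamari_point_from_last[OF assms(1) l, of j] assms
      by (simp add: slack_def)
  qed
qed

subsection \<open>Comparison with the cube\<close>

text \<open>
  Once the last \<open>j\<close> coordinates are fixed, the next one ranges over the interval from
  \<open>0\<close> to \<open>Suc j - tail_sum x j\<close>, of length at least 1; rescaling these intervals to
  unit length straightens the polytope to the cube.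
\<close>

definition to_cube :: "('m \<Rightarrow> nat) \<Rightarrow> (real, 'd::{finite,linorder}) vec \<Rightarrow> real ^ 'm" where
  "to_cube p x = (\<chi> i. x $ from_last (p i) / (real (Suc (p i)) - tail_sum x (p i)))"

definition cube_slack :: "bool \<times> 'm \<Rightarrow> real ^ 'm \<Rightarrow> real" where
  "cube_slack c y = (if fst c then 1 - y $ snd c else y $ snd c)"

text \<open>Inverse of the rescaling: the tail sums of the point whose coordinate \<open>j\<close>
  from the end lies at the fraction \<open>c j\<close> of its interval.\<close>

fun unscaled_sum :: "(nat \<Rightarrow> real) \<Rightarrow> nat \<Rightarrow> real" where
  "unscaled_sum c 0 = 0"
| "unscaled_sum c (Suc j) = unscaled_sum c j + c j * (real (Suc j) - unscaled_sum c j)"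

lemma unscaled_sum_bounds:
  assumes "\<And>j. j < n \<Longrightarrow> 0 \<le> c j \<and> c j \<le> 1" and "j \<le> n"
  shows "0 \<le> unscaled_sum c j \<and> unscaled_sum c j \<le> j"
  using assms(2)
proof (induction j)
  case (Suc j)
  let ?d = "real (Suc j) - unscaled_sum c j"
  have "0 \<le> ?d" "0 \<le> c j" "c j \<le> 1" using Suc assms(1)[of j] by auto
  then have "0 \<le> c j * ?d" "c j * ?d \<le> ?d"
    by (simp_all add: mult_left_le_one_le)
  then show ?case using Suc unfolding unscaled_sum.simps by linarith
qed simp

text \<open>The map is triangular: with the last \<open>j\<close> coordinates known, the next one is
  recovered by multiplying by a positive length. Strong induction gives injectivity,
  \<open>unscaled_sum\<close> a preimage.\<close>

lemma bij_betw_to_cube: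
  fixes p :: "'m::finite \<Rightarrow> nat"
  assumes card: "CARD('d::{finite,linorder}) = Suc n" and p: "bij_betw p UNIV {..<n}"
  shows "bij_betw (to_cube p) (slack_polytope n :: (real, 'd::{finite,linorder}) vec set) hypercube"
  unfolding bij_betw_def
proof
  have pn: "p i < n" for i using p by (auto simp: bij_betw_def)
  have pos: "0 < real (Suc j) - tail_sum x j" if "x \<in> slack_polytope n" "j < n"
    for j and x :: "(real, 'd) vec"
    using slack_polytope_tail_sum(2)[OF that(1), of j] that(2) by simp
  show "inj_on (to_cube p) (slack_polytope n :: (real, 'd) vec set)"
  proof (rule inj_onI)
    fix x y :: "(real, 'd) vec"
    assume x: "x \<in> slack_polytope n" and y: "y \<in> slack_polytope n" and eq: "to_cube p x = to_cube p y"
    show "x = y"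
    proof (rule vec_eq_from_last)
      fix j assume "j < CARD('d)"
      then show "x $ from_last j = y $ from_last j"
      proof (induction j rule: less_induct)
        case (less j)
        then have ts: "tail_sum x j = tail_sum y j"
          unfolding tail_sum_def by (intro sum.cong) auto
        show ?case
        proof (cases "j = n")
          case True
          \<comment> \<open>The first coordinate has no counterpart in the cube; the fixed total
            determines it.\<close>
          then show ?thesis using ts x y by (simp add: slack_polytope_def)
        next
          case False
          then have "j < n" using less.prems card by simp
          then obtain i where i: "p i = j" using p by (metis bij_betw_iff_bijections lessThan_iff)
          have "to_cube p x $ i = to_cube p y $ i" using eq by simp
          then show ?thesis
            using pos[OF x \<open>j < n\<close>] by (simp add: to_cube_def i ts)
        qed
      qed
    qed
  qed
  show "to_cube p ` (slack_polytope n :: (real, 'd) vec set) = hypercube"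
  proof (intro equalityI subsetI)
    fix y assume "y \<in> to_cube p ` (slack_polytope n :: (real, 'd) vec set)"
    then obtain x :: "(real, 'd) vec" where x: "x \<in> slack_polytope n" and y: "y = to_cube p x" by auto
    have "0 \<le> y $ i \<and> y $ i \<le> 1" for i
      using pos[OF x pn[of i]] slack_polytope_nonneg[OF x pn[of i]] pn[of i]
        slack_polytope_tail_sum(2)[OF x, of "Suc (p i)"]
      by (simp add: y to_cube_def)
    then show "y \<in> hypercube" by (simp add: hypercube_def mem_box_cart)
  next
    fix y :: "real ^ 'm" assume y: "y \<in> hypercube"
    define c where "c j = y $ inv_into UNIV p j" for j
    have c: "0 \<le> c j \<and> c j \<le> 1" for j using y by (simp add: c_def hypercube_def mem_box_cart)
    have bounds: "0 \<le> unscaled_sum c j" "unscaled_sum c j \<le> j" for j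
      using unscaled_sum_bounds[of j c j] c by auto
    define x :: "(real, 'd) vec" where
      "x = (\<chi> i. let j = card {i<..} in
         if j = n then real (Suc n) - unscaled_sum c n
         else c j * (real (Suc j) - unscaled_sum c j))"
    have xj: "x $ from_last j = c j * (real (Suc j) - unscaled_sum c j)" if "j < n" for j
      using that card by (simp add: x_def)
    have ts: "tail_sum x j = unscaled_sum c j" if "j \<le> n" for j
      using that by (induction j) (auto simp: xj)
    have "tail_sum x (Suc n) = real (Suc n)"
      using card by (simp add: ts) (simp add: x_def)
    moreover have "0 \<le> slack b j x" if "j < n" for b j
      using that bounds(2)[of "Suc j"] bounds(2)[of j] c[of j] ts[of "Suc j"]
      by (simp add: slack_def xj del: tail_sum_Suc unscaled_sum.simps)
    ultimately have "x \<in> slack_polytope n" by (simp add: slack_polytope_def del: tail_sum_Suc)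
    moreover have "to_cube p x $ i = y $ i" for i
    proof -
      have "real (Suc (p i)) - unscaled_sum c (p i) \<noteq> 0" using bounds(2)[of "p i"] by simp
      then have "to_cube p x $ i = c (p i)"
        using pn[of i] by (simp add: to_cube_def xj ts)
      then show ?thesis using p by (simp add: c_def bij_betw_def)
    qed
    then have "to_cube p x = y" by (simp add: vec_eq_iff)
    ultimately show "y \<in> to_cube p ` (slack_polytope n :: (real, 'd) vec set)" by blast
  qed
qed

text \<open>The denominator is positive, so the quotient is 0 exactly when the numerator is, and 1
  exactly when the numerator fills the interval, that is when the upper bound on the tail sum is
  attained.\<close>

lemma tightness_bijection_to_cube:
  fixes p :: "'m::finite \<Rightarrow> nat"
  assumes card: "CARD('d::{finite,linorder}) = Suc n" and p: "bij_betw p UNIV {..<n}"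
  shows "tightness_bijection {x. tail_sum x (Suc n) = real (Suc n)} UNIV UNIV
    (\<lambda>c. slack (fst c) (p (snd c))) cube_slack (to_cube p)
    (slack_polytope n :: (real, 'd::{finite,linorder}) vec set) hypercube"
proof
  show "affine_functional (cube_slack c)" for c :: "bool \<times> 'm"
    unfolding affine_functional_def cube_slack_def by (simp add: algebra_simps)
  have "(\<forall>j<n. P j) \<longleftrightarrow> (\<forall>i. P (p i))" for P
    using p by (metis UNIV_I bij_betw_iff_bijections lessThan_iff)
  then show "slack_polytope n = {x \<in> {x. tail_sum x (Suc n) = real (Suc n)}.
      \<forall>c\<in>UNIV. 0 \<le> slack (fst c) (p (snd c)) (x :: (real, 'd) vec)}"
    by (auto simp: slack_polytope_def)
  show "hypercube = {y \<in> UNIV. \<forall>c\<in>UNIV. 0 \<le> cube_slack c (y :: real ^ 'm)}"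
    by (auto simp: hypercube_def mem_box_cart cube_slack_def all_bool_eq split_paired_all)
  fix x :: "(real, 'd) vec" and c :: "bool \<times> 'm" assume x: "x \<in> slack_polytope n"
  have "p (snd c) < n" using p by (auto simp: bij_betw_def)
  then have "0 < real (Suc (p (snd c))) - tail_sum x (p (snd c))"
    using slack_polytope_tail_sum(2)[OF x, of "p (snd c)"] by simp
  then show "slack (fst c) (p (snd c)) x = 0 \<longleftrightarrow> cube_slack c (to_cube p x) = 0"
    by (auto simp: slack_def cube_slack_def to_cube_def eq_divide_eq divide_eq_eq)
qed (use bij_betw_to_cube[OF card p] in \<open>simp_all only: affine_tail_sum_level affine_UNIV finite affine_functional_slack\<close>)

text \<open>A coordinate strictly between 0 and 1 can be moved both ways. Conversely, a proper
  convex combination of numbers in the unit interval is 0 or 1 only if both numbers are.\<close>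

lemma extreme_point_of_hypercube:
  "y extreme_point_of (hypercube :: (real ^ 'm) set) \<longleftrightarrow> (\<forall>i. y $ i = 0 \<or> y $ i = 1)"
proof
  assume y: "y extreme_point_of (hypercube :: (real ^ 'm) set)"
  show "\<forall>i. y $ i = 0 \<or> y $ i = 1"
  proof (rule ccontr)
    assume "\<not> (\<forall>i. y $ i = 0 \<or> y $ i = 1)"
    then obtain i where i: "y $ i \<noteq> 0" "y $ i \<noteq> 1" by auto
    have y01: "0 \<le> y $ k \<and> y $ k \<le> 1" for k
      using y by (simp add: extreme_point_of_def hypercube_def mem_box_cart)
    define z where "z s = (\<chi> k. if k = i then s else y $ k)" for s
    have "z 0 \<in> hypercube" "z 1 \<in> hypercube"
      using y01 by (simp_all add: z_def hypercube_def mem_box_cart)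
    moreover have "y \<in> open_segment (z 0) (z 1)"
    proof -
      have "z 0 \<noteq> z 1" by (auto simp: z_def vec_eq_iff)
      moreover have "y = (1 - y $ i) *\<^sub>R z 0 + (y $ i) *\<^sub>R z 1"
        by (simp add: z_def vec_eq_iff algebra_simps)
      ultimately show ?thesis
        using i y01[of i] unfolding in_segment by (metis order_le_imp_less_or_eq)
    qed
    ultimately show False using y by (simp add: extreme_point_of_def)
  qed
next
  assume y: "\<forall>i. y $ i = 0 \<or> y $ i = 1"
  have "0 \<le> y $ i \<and> y $ i \<le> 1" for i
    using y[rule_format, of i] by auto
  then have "y \<in> hypercube" by (simp add: hypercube_def mem_box_cart)
  moreover have "y \<notin> open_segment a b" if a: "a \<in> hypercube" and b: "b \<in> hypercube" for a b
  proof
    assume "y \<in> open_segment a b"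
    then obtain u where u: "a \<noteq> b" "0 < u" "u < 1" "y = (1 - u) *\<^sub>R a + u *\<^sub>R b"
      by (auto simp: in_segment)
    have "a $ i = b $ i" for i
    proof -
      have ab: "0 \<le> a $ i" "a $ i \<le> 1" "0 \<le> b $ i" "b $ i \<le> 1"
        using a b by (simp_all add: hypercube_def mem_box_cart)
      have yi: "y $ i = (1 - u) * a $ i + u * b $ i" by (simp add: u(4))
      from y consider "y $ i = 0" | "y $ i = 1" by blast
      then show ?thesis
      proof cases
        case 1
        then show ?thesis using yi ab u by (simp add: add_nonneg_eq_0_iff)
      next
        case 2
        \<comment> \<open>Reflecting the interval reduces the value 1 to the value 0.\<close>
        then have "(1 - u) * (1 - a $ i) + u * (1 - b $ i) = 0" using yi by (simp add: algebra_simps)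
        then show ?thesis using ab u by (simp add: add_nonneg_eq_0_iff)
      qed
    qed
    then show False using u by (simp add: vec_eq_iff)
  qed
  ultimately show "y extreme_point_of hypercube" by (auto simp: extreme_point_of_def)
qed

text \<open>Under \<open>to_cube\<close> the point of \<open>\<alpha>\<close> becomes the 0/1 vector
  with ones at the \<open>Neg\<close> signs. Every vertex of the cube arises in this way, and
  extreme points correspond under the bijection.\<close>

lemma extreme_points_slack_polytope:
  fixes p :: "'m::finite \<Rightarrow> nat"
  assumes card: "CARD('d::{finite,linorder}) = Suc n" and p: "bij_betw p UNIV {..<n}"
  shows "{x. x extreme_point_of (slack_polytope n :: (real, 'd::{finite,linorder}) vec set)}
    = (\<lambda>\<alpha>. tamari_point (canopy_section \<alpha>)) ` {\<alpha>. length \<alpha> = n}"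
proof -
  interpret tightness_bijection "{x. tail_sum x (Suc n) = real (Suc n)}" UNIV UNIV
    "\<lambda>c. slack (fst c) (p (snd c))" cube_slack "to_cube p" "slack_polytope n :: (real, 'd) vec set" hypercube
    by (rule tightness_bijection_to_cube[OF assms])
  have to_cube_tight: "slack b (p i) x = 0 \<longleftrightarrow> to_cube p x $ i = of_bool b"
    if "x \<in> slack_polytope n" for b i and x :: "(real, 'd) vec"
    using tight[OF that, of "(b, i)"] by (auto simp: cube_slack_def)
  have pn: "p i < n" for i using p by (auto simp: bij_betw_def)
  let ?v = "\<lambda>\<alpha>. tamari_point (canopy_section \<alpha>) :: (real, 'd) vec"
  have v: "?v \<alpha> \<in> slack_polytope n" if "length \<alpha> = n" for \<alpha>
    using that by (intro tamari_point_in_slack_polytope[OF card]) (simp add: leaves_canopy_section)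
  have hv: "to_cube p (?v \<alpha>) $ i = of_bool (\<alpha> ! (n - Suc (p i)) = Neg)" if "length \<alpha> = n" for \<alpha> i
    using slack_canopy_section[OF card that pn] by (simp only: to_cube_tight[OF v[OF that]])
  show ?thesis
  proof (intro equalityI subsetI)
    fix x assume "x \<in> ?v ` {\<alpha>. length \<alpha> = n}"
    then obtain \<alpha> where \<alpha>: "length \<alpha> = n" "x = ?v \<alpha>" by auto
    have "to_cube p x extreme_point_of hypercube"
      by (simp add: extreme_point_of_hypercube \<alpha> hv)
    then show "x \<in> {x. x extreme_point_of slack_polytope n}"
      using v[OF \<alpha>(1)] by (simp add: extreme_point_image_iff \<alpha>(2))
  next
    fix x :: "(real, 'd) vec" assume "x \<in> {x. x extreme_point_of slack_polytope n}"
    then have "x extreme_point_of slack_polytope n" by simp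
    moreover from this have x: "x \<in> slack_polytope n" by (simp add: extreme_point_of_def)
    ultimately have x01: "to_cube p x $ i = 0 \<or> to_cube p x $ i = 1" for i
      by (simp flip: extreme_point_image_iff add: extreme_point_of_hypercube)
    \<comment> \<open>The signs record which bound is tight; list positions run opposite to the
      numbering from the end.\<close>
    define \<alpha> where "\<alpha> = map (\<lambda>k. if slack True (n - Suc k) x = 0 then Neg else Pos) [0..<n]"
    have len: "length \<alpha> = n" by (simp add: \<alpha>_def)
    have "to_cube p (?v \<alpha>) $ i = to_cube p x $ i" for i
    proof -
      have "\<alpha> ! (n - Suc (p i)) = Neg \<longleftrightarrow> to_cube p x $ i = 1"
        using pn[of i] to_cube_tight[OF x, of True i] by (simp add: \<alpha>_def)
      then show ?thesis using x01[of i] by (auto simp: hv[OF len])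
    qed
    then have "to_cube p (?v \<alpha>) = to_cube p x" by (simp add: vec_eq_iff)
    then have "?v \<alpha> = x"
      using bij_betw_imp_inj_on[OF bij] v[OF len] x by (auto dest: inj_onD)
    then show "x \<in> ?v ` {\<alpha>. length \<alpha> = n}" using len by auto
  qed
qed

text \<open>All Tamari points satisfy the inequalities, and the vertices of the convex compact set
  they cut out are themselves Tamari points.\<close>

lemma tamari_polytope_eq_slack_polytope:
  fixes p :: "'m::finite \<Rightarrow> nat"
  assumes card: "CARD('d::{finite,linorder}) = Suc n" and p: "bij_betw p UNIV {..<n}"
  shows "(tamari_polytope n :: (real, 'd::{finite,linorder}) vec set) = slack_polytope n"
proof
  show "tamari_polytope n \<subseteq> (slack_polytope n :: (real, 'd) vec set)"
    unfolding tamari_polytope_def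
    by (intro hull_minimal convex_slack_polytope)
      (auto simp: PBT_def intro!: tamari_point_in_slack_polytope card)
  have "(slack_polytope n :: (real, 'd) vec set)
      = convex hull {x. x extreme_point_of slack_polytope n}"
    by (rule Krein_Milman_Minkowski[OF compact_slack_polytope[OF card] convex_slack_polytope])
  also have "\<dots> \<subseteq> tamari_polytope n"
    unfolding extreme_points_slack_polytope[OF card p] tamari_polytope_def
    by (intro hull_mono) (auto simp: PBT_def leaves_canopy_section)
  finally show "(slack_polytope n :: (real, 'd) vec set) \<subseteq> tamari_polytope n" .
qed

lemma slack_face_of_slack_polytope:
  assumes "j < n"
  shows "{x \<in> slack_polytope n. slack b j x = 0} face_of slack_polytope n"
proof -
  have *: "slack_polytope n = {x \<in> {x. tail_sum x (Suc n) = real (Suc n)}.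
      \<forall>c\<in>{..<n} \<times> UNIV. 0 \<le> slack (snd c) (fst c) x}"
    by (auto simp: slack_polytope_def)
  have "{x \<in> slack_polytope n. \<forall>c\<in>{(j, b)}. slack (snd c) (fst c) x = 0} face_of slack_polytope n"
    unfolding * using assms
    by (intro tight_set_face_of affine_tail_sum_level affine_functional_slack) auto
  then show ?thesis by simp
qed

theorem proposition3:
  fixes n :: nat
    and KT :: "(real ^ 'd::{finite,linorder}) set"
    and cube :: "(real ^ 'm::finite) set"
  assumes "n \<ge> 1"
    and "CARD('d) = n + 1"
    and "CARD('m) = n"
    and "KT = tamari_polytope n"
    and "cube = hypercube"
  shows "polytope KT \<and> combinatorially_equivalent KT cube
    \<and> {x. x extreme_point_of KT} = (\<lambda>\<alpha>. tamari_point (canopy_section \<alpha>)) ` {\<alpha>. length \<alpha> = n}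
    \<and> (\<forall>t \<in> PBT (n + 2). \<exists>F. F face_of KT \<and> F \<noteq> KT
          \<and> tamari_point t \<in> F \<and> tamari_point (canopy_section (canopy t)) \<in> F)"
proof -
  have card: "CARD('d) = Suc n" using assms by simp
  obtain p :: "'m \<Rightarrow> nat" where p: "bij_betw p UNIV {..<n}"
    using finite_same_card_bij[of "UNIV :: 'm set" "{..<n}"] assms by auto
  have KT: "KT = slack_polytope n"
    using tamari_polytope_eq_slack_polytope[OF card p] assms by simp
  have extreme: "{x. x extreme_point_of KT} = (\<lambda>\<alpha>. tamari_point (canopy_section \<alpha>)) ` {\<alpha>. length \<alpha> = n}"
    unfolding KT by (rule extreme_points_slack_polytope[OF card p])
  have "KT = convex hull {x. x extreme_point_of KT}"
    unfolding KT
    by (rule Krein_Milman_Minkowski[OF compact_slack_polytope[OF card] convex_slack_polytope])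
  moreover have "finite {\<alpha> :: pm_sign list. length \<alpha> = n}"
  proof -
    have "(UNIV :: pm_sign set) = {Neg, Pos}" using pm_sign.exhaust by auto
    then have "finite (UNIV :: pm_sign set)" using finite.simps by blast
    then show ?thesis using finite_lists_length_eq[of "UNIV :: pm_sign set" n] by simp
  qed
  ultimately have "polytope KT"
    unfolding polytope_def extreme by blast
  moreover have "combinatorially_equivalent KT cube"
    unfolding KT assms(5)
    by (rule tightness_bijection.combinatorially_equivalent[OF tightness_bijection_to_cube[OF card p]])
  moreover have "\<exists>F. F face_of KT \<and> F \<noteq> KT
      \<and> tamari_point t \<in> F \<and> tamari_point (canopy_section (canopy t)) \<in> F" if "t \<in> PBT (n + 2)" for t
  proof -
    have t: "leaves t = n + 2" using that by (simp add: PBT_def)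
    then have len: "length (canopy t) = n" by (simp add: length_canopy)
    have in_KT: "tamari_point s \<in> KT" if "leaves s = n + 2" for s
      unfolding KT by (rule tamari_point_in_slack_polytope[OF card that])
    have section_in: "tamari_point (canopy_section \<alpha>) \<in> KT" if "length \<alpha> = n" for \<alpha>
      using that by (intro in_KT) (simp add: leaves_canopy_section)
    \<comment> \<open>The last interior leaf governs the pair \<open>j = 0\<close>, that is
      \<open>0 \<le> a\<^sub>n \<le> 1\<close>. Since \<open>a\<^sub>n\<close> is an integer, one of
      these two bounds is tight, and the sign of the leaf tells which.\<close>
    let ?neg = "canopy t ! (n - 1) = Neg"
    define F where "F = {x \<in> KT. slack ?neg 0 x = 0}"
    have "F face_of KT"
      unfolding F_def KT using assms(1) by (intro slack_face_of_slack_polytope) simp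
    moreover have "F \<noteq> KT"
    proof -
      \<comment> \<open>The opposite last sign puts a vertex on the opposite facet. The two slacks
        for \<open>j = 0\<close> add up to 1, so this vertex is outside \<open>F\<close>.\<close>
      define \<alpha> where "\<alpha> = replicate n (if ?neg then Pos else Neg)"
      have "slack (\<not> ?neg) 0 (tamari_point (canopy_section \<alpha>) :: (real, 'd) vec) = 0"
        using slack_canopy_section[OF card, of \<alpha> 0] assms(1) by (auto simp: \<alpha>_def split: if_splits)
      then have "slack ?neg 0 (tamari_point (canopy_section \<alpha>) :: (real, 'd) vec) \<noteq> 0"
        by (auto simp: slack_def split: if_splits)
      then show ?thesis using section_in[of \<alpha>] by (auto simp: F_def \<alpha>_def)
    qed
    moreover have "tamari_point t \<in> F"
    proof -
      have o: "(tamari_point t :: (real, 'd) vec) $ from_last 0 = opens t ! n"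
        using tamari_point_from_last[OF card t, of 0] by simp
      have dir: "?neg \<longleftrightarrow> opens t ! n \<noteq> 0"
        using canopy_nth[of "n - 1" t] t assms(1) by simp
      have "0 \<le> slack True 0 (tamari_point t :: (real, 'd) vec)"
        using in_KT[OF t] assms(1) by (simp add: KT slack_polytope_def)
      then have "opens t ! n \<le> 1" by (simp add: slack_def o)
      then have "slack ?neg 0 (tamari_point t :: (real, 'd) vec) = 0"
        using dir o by (cases "opens t ! n") (auto simp: slack_def)
      then show ?thesis using in_KT[OF t] by (simp add: F_def)
    qed
    moreover have "tamari_point (canopy_section (canopy t)) \<in> F"
      using section_in[OF len] slack_canopy_section[OF card len, of 0] assms(1) by (simp add: F_def)
    ultimately show ?thesis by blast
  qed
  ultimately show ?thesis using extreme by blast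
qed

end
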